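(* Assume that the series solution $\sum_{k=0}^{\infty}y_k(x)$ is convergent to the solution $y(x)$ of the problem $$y(x)-g(x)-\int_0^1G(x,s)\,q(s)\,f(s,y(s))\,ds=0 .$$ If the truncated series $\phi_M(x,c_0)=\sum_{m=0}^{M}y_m(x,c_0)$ is used as an approximation to the solution $y(x)$ of this problem, then the maximum absolute truncated error is estimated as $$\left|y(x)-\phi_M(x,c_0)\right|\le\frac{1}{1-\delta}\,\delta^{M-k_0+1}\,\|y_{k_0}\| .$$
   Context: Notation for the constants: $\delta$ with $0<\delta<1$ and $k_0\in\mathbb{N}$ are the constants in the condition $\|y_{k+1}\|\le\delta\|y_k\|$ for all $k\ge k_0$ on the solution components $y_k$ defined below. Here $\|y\|=\max_{x\in[0,1]}|y(x)|$ is the norm of the Banach space $\mathbb{X}=C[0,1]$. The problem is the integral form of the doubly singular boundary value problem $-(p(x)y'(x))'=q(x)f(x,y(x))$, $0<x<1$, with boundary conditions (I) or (II) below, where $\delta_1,\alpha_i,\beta_i,\gamma_i$ ($i=1,2$) are real constants. The following is assumed throughout. $p(0)=0$, and $q$ may be discontinuous at $0$; $p\in C[0,1]\cap C^1(0,1]$; $p(x)>0$ and $q(x)>0$ on $(0,1]$; $f,f_y\in C(\Omega)$ and $f_y\ge0$ on $\Omega=(0,1]\times\mathbb{R}$, where $f_y=\partial f/\partial y$. (I) $y(0)=\delta_1$, $\alpha_1y(1)+\beta_1y'(1)=\gamma_1$, with $\frac1p\in L^1(0,1]$ and $\int_0^1\frac1{p(x)}\int_x^1q(s)\,ds\,dx<\infty$.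 With $h(x)=\int_0^x\frac{dt}{p(t)}$, $h'(1)=\frac1{p(1)}$ and $\mu=\alpha_1h(1)+\beta_1h'(1)$, $$g(x)=\delta_1+\frac{1}{\mu}(\gamma_1-\delta_1\alpha_1)h(x),\qquad G(x,s)=\begin{cases}h(x)\left[1-\frac{\alpha_1h(s)}{\mu}\right],&0\le x\le s,\\ h(s)\left[1-\frac{\alpha_1h(x)}{\mu}\right],&s\le x\le1.\end{cases}$$ (II) $\lim_{x\to0}p(x)y'(x)=0$ (or $y'(0)=0$), $\alpha_2y(1)+\beta_2y'(1)=\gamma_2$, with $q\in L^1(0,1]$ and $\int_0^1\frac1{p(x)}\int_0^xq(s)\,ds\,dx<\infty$. Then $$g(x)=\frac{\gamma_2}{\alpha_2},\qquad G(x,s)=\begin{cases}\int_s^1\frac{dt}{p(t)}+\frac{\beta_2}{\alpha_2p(1)},&0<x\le s,\\ \int_s^1\frac{dt}{p(t)}-\int_s^x\frac{dt}{p(t)}+\frac{\beta_2}{\alpha_2p(1)},&s\le x\le1.\end{cases}$$ Solution components. Let $c_0\ne0$ be the convergence-control parameter, and for $k\ge1$ let $$\mathcal{D}_{k-1}[f(\phi)]=\frac{1}{(k-1)!}\frac{\partial^{k-1}}{\partial r^{k-1}}f\Big(s,\sum_{j=0}^{\infty}y_j(s)r^j\Big)\Big|_{r=0}$$ be the homotopy-derivative operator of order $k-1$. The components $y_k(x)=y_k(x,c_0)$ are given by $y_0(x)=g(x)$, $$y_1(x)=c_0\Big\{y_0(x)-g(x)-\int_0^1G(x,s)q(s)\mathcal{D}_0[f(\phi)]\,ds\Big\},$$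 $$y_k(x)=(1+c_0)y_{k-1}(x)-c_0\int_0^1G(x,s)q(s)\mathcal{D}_{k-1}[f(\phi)]\,ds\qquad(k\ge2).$$
   Formalization: The formal statement adds the condition k_0 ≤ M+1 (nonnegative exponent); for M < k_0 − 1 the bound fails, e.g. f = 1, c_0 = −1, k_0 = 2, M = 0, where y_1 ≠ 0 but y_k = 0 for all k ≥ 2. *)

theory Defs
  imports "HOL-Analysis.Analysis"
begin

text \<open>Functions on \<open>[0,1]\<close> or \<open>(0,1]\<close> are total functions on the reals whose values elsewhere are
  never used. All integrals are Lebesgue integrals; the endpoint \<open>0\<close>, where the data may be
  singular or undefined, is left out of the domain of integration.\<close>

text \<open>The norm of \<open>C[0,1]\<close>. For \<open>u\<close> continuous on \<open>[0,1]\<close> the supremum is a maximum.\<close>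

definition cnorm :: "(real \<Rightarrow> real) \<Rightarrow> real" where
  "cnorm u = (SUP x\<in>{0..1}. \<bar>u x\<bar>)"

definition standing_assms ::
    "(real \<Rightarrow> real) \<Rightarrow> (real \<Rightarrow> real) \<Rightarrow> (real \<Rightarrow> real \<Rightarrow> real) \<Rightarrow> bool" where
  "standing_assms p q f \<longleftrightarrow>
     p 0 = 0 \<and>
     continuous_on {0..1} p \<and>
     (\<exists>p'. (\<forall>x\<in>{0<..1}. (p has_real_derivative p' x) (at x within {0<..1})) \<and>
           continuous_on {0<..1} p') \<and>
     (\<forall>x\<in>{0<..1}. p x > 0 \<and> q x > 0) \<and>
     continuous_on ({0<..1} \<times> UNIV) (\<lambda>(x, y). f x y) \<and>
     (\<forall>x\<in>{0<..1}. \<forall>y. f x differentiable (at y)) \<and>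
     continuous_on ({0<..1} \<times> UNIV) (\<lambda>(x, y). deriv (f x) y) \<and>
     (\<forall>x\<in>{0<..1}. \<forall>y. deriv (f x) y \<ge> 0)"


subsection \<open>Boundary conditions (I)\<close>

definition h_I :: "(real \<Rightarrow> real) \<Rightarrow> real \<Rightarrow> real" where
  "h_I p x = (LINT t:{0<..x}|lebesgue. 1 / p t)"

text \<open>Here \<open>h'(1) = 1 / p 1\<close>.\<close>

definition mu_I :: "(real \<Rightarrow> real) \<Rightarrow> real \<Rightarrow> real \<Rightarrow> real" where
  "mu_I p \<alpha>1 \<beta>1 = \<alpha>1 * h_I p 1 + \<beta>1 * (1 / p 1)"

text \<open>Since \<open>p\<close> and \<open>q\<close> are positive on \<open>(0,1]\<close>, finiteness of the iterated integral amounts to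
  integrability of the inner and of the outer integrand. The formulas for \<open>g\<close> and \<open>G\<close> divide by
  \<open>\<mu>\<close>, which must therefore be nonzero.\<close>

definition assms_I :: "(real \<Rightarrow> real) \<Rightarrow> (real \<Rightarrow> real) \<Rightarrow> real \<Rightarrow> real \<Rightarrow> bool" where
  "assms_I p q \<alpha>1 \<beta>1 \<longleftrightarrow>
     set_integrable lebesgue {0<..1} (\<lambda>x. 1 / p x) \<and>
     (\<forall>x\<in>{0<..1}. set_integrable lebesgue {x..1} q) \<and>
     set_integrable lebesgue {0<..1} (\<lambda>x. 1 / p x * (LINT s:{x..1}|lebesgue. q s)) \<and>
     mu_I p \<alpha>1 \<beta>1 \<noteq> 0"

definition g_I :: "(real \<Rightarrow> real) \<Rightarrow> real \<Rightarrow> real \<Rightarrow> real \<Rightarrow> real \<Rightarrow> real \<Rightarrow> real" where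
  "g_I p \<delta>1 \<alpha>1 \<beta>1 \<gamma>1 x = \<delta>1 + 1 / mu_I p \<alpha>1 \<beta>1 * (\<gamma>1 - \<delta>1 * \<alpha>1) * h_I p x"

definition G_I :: "(real \<Rightarrow> real) \<Rightarrow> real \<Rightarrow> real \<Rightarrow> real \<Rightarrow> real \<Rightarrow> real" where
  "G_I p \<alpha>1 \<beta>1 x s =
     (if x \<le> s then h_I p x * (1 - \<alpha>1 * h_I p s / mu_I p \<alpha>1 \<beta>1)
      else h_I p s * (1 - \<alpha>1 * h_I p x / mu_I p \<alpha>1 \<beta>1))"


subsection \<open>Boundary conditions (II)\<close>

text \<open>As for \<open>\<mu>\<close> above, \<open>\<alpha>2\<close> occurs as a denominator.\<close>

definition assms_II :: "(real \<Rightarrow> real) \<Rightarrow> (real \<Rightarrow> real) \<Rightarrow> real \<Rightarrow> bool" where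
  "assms_II p q \<alpha>2 \<longleftrightarrow>
     set_integrable lebesgue {0<..1} q \<and>
     set_integrable lebesgue {0<..1} (\<lambda>x. 1 / p x * (LINT s:{0<..x}|lebesgue. q s)) \<and>
     \<alpha>2 \<noteq> 0"

definition g_II :: "real \<Rightarrow> real \<Rightarrow> real \<Rightarrow> real" where
  "g_II \<alpha>2 \<gamma>2 x = \<gamma>2 / \<alpha>2"

text \<open>The branch \<open>0 < x \<le> s\<close> is extended to \<open>x = 0\<close> by the same expression, which does not
  depend on \<open>x\<close>.\<close>

definition G_II :: "(real \<Rightarrow> real) \<Rightarrow> real \<Rightarrow> real \<Rightarrow> real \<Rightarrow> real \<Rightarrow> real" where
  "G_II p \<alpha>2 \<beta>2 x s =
     (if x \<le> s then (LINT t:{s..1}|lebesgue. 1 / p t) + \<beta>2 / (\<alpha>2 * p 1)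
      else (LINT t:{s..1}|lebesgue. 1 / p t) - (LINT t:{s..x}|lebesgue. 1 / p t)
             + \<beta>2 / (\<alpha>2 * p 1))"


subsection \<open>The integral equation and the solution components\<close>

text \<open>Bochner integrals and \<open>deriv\<close> are total, with arbitrary values where the integral or the
  derivative does not exist. Existence, which the formulas presuppose, is therefore
  stated explicitly below.\<close>

definition is_solution ::
    "(real \<Rightarrow> real) \<Rightarrow> (real \<Rightarrow> real \<Rightarrow> real) \<Rightarrow> (real \<Rightarrow> real) \<Rightarrow> (real \<Rightarrow> real \<Rightarrow> real)
     \<Rightarrow> (real \<Rightarrow> real) \<Rightarrow> bool" where
  "is_solution g G q f y \<longleftrightarrow>
     continuous_on {0..1} y \<and>
     (\<forall>x\<in>{0..1}.
        set_integrable lebesgue {0<..1} (\<lambda>s. G x s * q s * f s (y s)) \<and>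
        y x - g x - (LINT s:{0<..1}|lebesgue. G x s * q s * f s (y s)) = 0)"

definition embedded ::
    "(real \<Rightarrow> real \<Rightarrow> real) \<Rightarrow> (nat \<Rightarrow> real \<Rightarrow> real) \<Rightarrow> real \<Rightarrow> real \<Rightarrow> real" where
  "embedded f u s r = f s (\<Sum>j. u j s * r ^ j)"

definition homotopy_deriv ::
    "nat \<Rightarrow> (real \<Rightarrow> real \<Rightarrow> real) \<Rightarrow> (nat \<Rightarrow> real \<Rightarrow> real) \<Rightarrow> real \<Rightarrow> real" where
  "homotopy_deriv n f u s = 1 / fact n * (deriv ^^ n) (embedded f u s) 0"

text \<open>Existence of the \<open>n\<close>-th derivative at \<open>a\<close>: the derivatives of order below \<open>n - 1\<close> are
  differentiable near \<open>a\<close>, the one of order \<open>n - 1\<close> at \<open>a\<close>.\<close>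

definition times_differentiable_at :: "nat \<Rightarrow> (real \<Rightarrow> real) \<Rightarrow> real \<Rightarrow> bool" where
  "times_differentiable_at n F a \<longleftrightarrow>
     (\<forall>m<n. (deriv ^^ m) F differentiable (at a) \<and>
        (Suc m < n \<longrightarrow> (\<forall>\<^sub>F r in at a. (deriv ^^ m) F differentiable (at r))))"

text \<open>The operator of order \<open>k - 1\<close> only involves \<open>u 0, \<dots>, u (k - 1)\<close>, although the series in
  \<open>r\<close> mentions all components. The components are thus characterised by the relations below
  rather than by a recursive definition. Convergence of the series in \<open>r\<close> for \<open>\<bar>r\<bar> < 1\<close> follows from
  convergence of \<open>\<Sum>k. u k s\<close>.\<close>

definition solution_components ::
    "real \<Rightarrow> (real \<Rightarrow> real) \<Rightarrow> (real \<Rightarrow> real \<Rightarrow> real) \<Rightarrow> (real \<Rightarrow> real) \<Rightarrow> (real \<Rightarrow> real \<Rightarrow> real)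
     \<Rightarrow> (nat \<Rightarrow> real \<Rightarrow> real) \<Rightarrow> bool" where
  "solution_components c0 g G q f u \<longleftrightarrow>
     (\<forall>k. continuous_on {0..1} (u k)) \<and>
     (\<forall>k\<ge>1. \<forall>s\<in>{0<..1}. times_differentiable_at (k - 1) (embedded f u s) 0) \<and>
     (\<forall>k\<ge>1. \<forall>x\<in>{0..1}.
        set_integrable lebesgue {0<..1} (\<lambda>s. G x s * q s * homotopy_deriv (k - 1) f u s)) \<and>
     (\<forall>x\<in>{0..1}. u 0 x = g x) \<and>
     (\<forall>x\<in>{0..1}. u 1 x = c0 * (u 0 x - g x -
        (LINT s:{0<..1}|lebesgue. G x s * q s * homotopy_deriv 0 f u s))) \<and>
     (\<forall>k\<ge>2. \<forall>x\<in>{0..1}. u k x = (1 + c0) * u (k - 1) x -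
        c0 * (LINT s:{0<..1}|lebesgue. G x s * q s * homotopy_deriv (k - 1) f u s))"

end

theory Submission
  imports Defs
begin

text \<open>The error of a truncated convergent series is its tail. Iterating the contraction of the
  norms shows that, from index \<open>M + 1\<close> on, the components are dominated at every point of \<open>[0,1]\<close>
  by a geometric series of ratio \<open>\<delta>\<close> with first term \<open>\<delta> ^ (M + 1 - k0) * cnorm (u k0)\<close>, and the
  sum of that series is the bound (\<open>eventual_contraction_geometric\<close>, \<open>geometric_tail_bound\<close>).
  The passage from norms to pointwise values rests on the continuity of the components on the
  compact interval (\<open>abs_le_cnorm\<close>).\<close>

text \<open>Without continuity the supremum in \<^const>\<open>cnorm\<close> could range over an unbounded set and
  would then say nothing about the values of the function.\<close>

lemma abs_le_cnorm:
  assumes "continuous_on {0..1} v" and "x \<in> {0..1}"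
  shows "\<bar>v x\<bar> \<le> cnorm v"
proof -
  have "compact ((\<lambda>x. \<bar>v x\<bar>) ` {0..1})"
    using assms(1) by (intro compact_continuous_image continuous_intros) auto
  then have "bdd_above ((\<lambda>x. \<bar>v x\<bar>) ` {0..1})"
    by (intro bounded_imp_bdd_above compact_imp_bounded)
  then show ?thesis
    unfolding cnorm_def using assms(2) by (rule cSUP_upper2) simp
qed

lemma eventual_contraction_geometric:
  fixes a :: "nat \<Rightarrow> real"
  assumes "0 \<le> d" and "\<forall>k\<ge>N. a (Suc k) \<le> d * a k"
  shows "a (N + n) \<le> d ^ n * a N"
proof (induction n)
  case (Suc n)
  have "a (N + Suc n) \<le> d * a (N + n)"
    using assms(2) by simp
  also have "\<dots> \<le> d * (d ^ n * a N)"
    using Suc assms(1) by (rule mult_left_mono)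
  finally show ?case by (simp add: mult_ac)
qed simp

lemma geometric_tail_bound:
  fixes a :: "nat \<Rightarrow> 'a::banach"
  assumes "a sums l" and "0 \<le> d" and "d < 1"
    and bound: "\<And>i. norm (a (n + i)) \<le> d ^ i * B"
  shows "norm (l - (\<Sum>i<n. a i)) \<le> 1 / (1 - d) * B"
proof -
  have tail: "(\<lambda>i. a (n + i)) sums (l - (\<Sum>i<n. a i))"
    using sums_split_initial_segment[OF assms(1), of n] by (simp add: add.commute)
  have geom: "(\<lambda>i. d ^ i * B) sums (1 / (1 - d) * B)"
    using assms(2,3) by (intro sums_mult2 geometric_sums) simp
  have "norm (\<Sum>i. a (n + i)) \<le> (\<Sum>i. d ^ i * B)"
    using bound geom by (intro norm_suminf_le) (auto simp: sums_iff)
  then show ?thesis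
    using tail geom by (simp add: sums_iff)
qed

theorem theorem3p2:
  fixes p q :: "real \<Rightarrow> real"
    and f :: "real \<Rightarrow> real \<Rightarrow> real"
    and g :: "real \<Rightarrow> real"
    and G :: "real \<Rightarrow> real \<Rightarrow> real"
    and \<delta>1 \<alpha>1 \<beta>1 \<gamma>1 \<alpha>2 \<beta>2 \<gamma>2 c0 \<delta> :: real
    and k0 M :: nat
    and u :: "nat \<Rightarrow> real \<Rightarrow> real"
    and y :: "real \<Rightarrow> real"
  assumes "standing_assms p q f"
    and "(assms_I p q \<alpha>1 \<beta>1 \<and> g = g_I p \<delta>1 \<alpha>1 \<beta>1 \<gamma>1 \<and> G = G_I p \<alpha>1 \<beta>1) \<or>
         (assms_II p q \<alpha>2 \<and> g = g_II \<alpha>2 \<gamma>2 \<and> G = G_II p \<alpha>2 \<beta>2)"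
    and "c0 \<noteq> 0"
    and "solution_components c0 g G q f u"
    and "0 < \<delta>" and "\<delta> < 1"
    and "\<forall>k\<ge>k0. cnorm (u (Suc k)) \<le> \<delta> * cnorm (u k)"
    and "is_solution g G q f y"
    and "\<forall>x\<in>{0..1}. (\<lambda>k. u k x) sums y x"
    and "k0 \<le> M + 1"
  shows "\<forall>x\<in>{0..1}. \<bar>y x - (\<Sum>m\<le>M. u m x)\<bar> \<le> 1 / (1 - \<delta>) * \<delta> ^ (M + 1 - k0) * cnorm (u k0)"
proof
  fix x :: real
  assume x: "x \<in> {0..1}"
  let ?B = "\<delta> ^ (M + 1 - k0) * cnorm (u k0)"
  have cont: "continuous_on {0..1} (u k)" for k
    using assms(4) by (simp add: solution_components_def)
  have "norm (u (Suc M + i) x) \<le> \<delta> ^ i * ?B" for i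
  proof -
    have split: "Suc M + i = k0 + (i + (M + 1 - k0))"
      using \<open>k0 \<le> M + 1\<close> by simp
    have "norm (u (Suc M + i) x) \<le> cnorm (u (Suc M + i))"
      using abs_le_cnorm[OF cont x] by simp
    also have "\<dots> \<le> \<delta> ^ (i + (M + 1 - k0)) * cnorm (u k0)"
      unfolding split
      using \<open>0 < \<delta>\<close> assms(7)
      by (intro eventual_contraction_geometric[where a = "\<lambda>k. cnorm (u k)"]) auto
    finally show ?thesis by (simp add: power_add mult.assoc)
  qed
  then have "norm (y x - (\<Sum>m<Suc M. u m x)) \<le> 1 / (1 - \<delta>) * ?B"
    using assms(9) x \<open>0 < \<delta>\<close> \<open>\<delta> < 1\<close>
    by (intro geometric_tail_bound) auto
  then show "\<bar>y x - (\<Sum>m\<le>M. u m x)\<bar> \<le> 1 / (1 - \<delta>) * \<delta> ^ (M + 1 - k0) * cnorm (u k0)"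
    by (simp only: lessThan_Suc_atMost real_norm_def mult.assoc)
qed

end
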